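(* Let $m\in\mathbb{Z}_{>0}$. The set $$B(m)=\left\{\mu\in\Lambda(m):\mu_1+\mu_2=m+2,\ \binom{m}{\mu_1-1}\not\equiv0\pmod p\right\}$$ is the set of minimal elements of $\Lambda(m)\setminus\Gamma(m)$ (with respect to the componentwise order). Hence $\Lambda(m)\setminus\Gamma(m)=\mathcal{U}(B(m))$.
   Context: Let $p$ be a prime, $\mathbb{F}=\mathbb{F}_p$, $S=\mathbb{F}[x,y]$, $\mathrm{Der}_S=S\partial_x\oplus S\partial_y$. Let $\mathcal{A}=\{H_1,H_2,H_3\}$ with $H_1=\ker x$, $H_2=\ker y$, $H_3=\ker(x+y)$, $\alpha_1=x,\alpha_2=y,\alpha_3=x+y$. For $\mu=(\mu_1,\mu_2,\mu_3)\in\mathbb{Z}_{\ge0}^3$, $D(\mathcal{A},\mu)=\{\theta\in\mathrm{Der}_S:\theta(\alpha_i)\in\alpha_i^{\mu_i}S,\ i=1,2,3\}$. Let $\Lambda(m)=\{\mu\in\mathbb{Z}_{\ge0}^3:\mu_3=m\}$, partially ordered componentwise ($\mu\subseteq\nu$ iff $\mu_i\le\nu_i$ for all $i$). For $\mu\in\Lambda(m)$ let $\psi_\mu=\sum_{j=\mu_1}^{m}\binom{m}{j}x^jy^{m-j}\partial_x+\sum_{j=0}^{\mu_1-1}\binom{m}{j}x^jy^{m-j}\partial_y$ (binomial coefficients read in $\mathbb{F}_p$; empty sums are zero) and $\psi'_\mu=x^{\mu_1}y^{\mu_2}(\partial_y-\partial_x)$, and let $\Gamma(m)=\{\mu\in\Lambda(m):\{\psi_\mu,\psi'_\mu\}\text{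 is a basis for }D(\mathcal{A},\mu)\}$. For $T\subseteq\Lambda(m)$, $\mathcal{U}(T)=\{\mu\in\Lambda(m):\nu\subseteq\mu\text{ for some }\nu\in T\}$ is the upper set generated by $T$. *)

theory Defs
  imports
    "Berlekamp_Zassenhaus.Finite_Field"
    "HOL-Computational_Algebra.Polynomial"
    "HOL-Library.Product_Plus"
    "HOL-Library.Product_Order"
begin

text \<open>
  The ring \<open>S = F[x, y]\<close> is \<open>(F[x])[y]\<close>: the inner polynomial variable is \<open>x\<close>, the outer one \<open>y\<close>.
  For \<open>F = F\<^sub>p\<close> the type \<open>'a\<close> below is \<open>'p mod_ring\<close> with \<open>'p :: prime_card\<close> and \<open>p = CARD('p)\<close>.
\<close>

type_synonym 'a bipoly = "'a poly poly"

definition X :: "'a::field bipoly" where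
  "X = [:[:0, 1:]:]"

definition Y :: "'a::field bipoly" where
  "Y = [:0, 1:]"

definition dX :: "'a::field bipoly \<Rightarrow> 'a bipoly" where
  "dX f = map_poly pderiv f"

definition dY :: "'a::field bipoly \<Rightarrow> 'a bipoly" where
  "dY f = pderiv f"

text \<open>
  \<open>Der\<^sub>S = S \<partial>\<^sub>x \<oplus> S \<partial>\<^sub>y\<close>: the pair \<open>(f, g)\<close> stands for the derivation \<open>f \<partial>\<^sub>x + g \<partial>\<^sub>y\<close>.
\<close>

type_synonym 'a der = "'a bipoly \<times> 'a bipoly"

definition der_apply :: "'a::field der \<Rightarrow> 'a bipoly \<Rightarrow> 'a bipoly" where
  "der_apply \<theta> h = fst \<theta> * dX h + snd \<theta> * dY h"

definition der_scale :: "'a::field bipoly \<Rightarrow> 'a der \<Rightarrow> 'a der" where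
  "der_scale h \<theta> = (h * fst \<theta>, h * snd \<theta>)"

interpretation der: Modules.module "der_scale :: 'a::field bipoly \<Rightarrow> 'a der \<Rightarrow> 'a der"
  by unfold_locales (simp_all add: der_scale_def algebra_simps)

definition is_basis :: "'a::field der set \<Rightarrow> 'a der set \<Rightarrow> bool" where
  "is_basis B M \<longleftrightarrow> der.independent B \<and> der.span B = M"

lemma der_apply_X: "der_apply \<theta> X = fst \<theta>"
  by (simp add: der_apply_def X_def dX_def dY_def map_poly_pCons pderiv_pCons flip: one_pCons)

lemma der_apply_Y: "der_apply \<theta> Y = snd \<theta>"
  by (simp add: der_apply_def Y_def dX_def dY_def map_poly_pCons pderiv_pCons)

text \<open>
  A multiplicity \<open>\<mu> = (\<mu>\<^sub>1, \<mu>\<^sub>2, \<mu>\<^sub>3)\<close> is a triple of naturals; \<open>\<le>\<close> on triples is the componentwise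
  order of \<^theory>\<open>HOL-Library.Product_Order\<close>.
\<close>

type_synonym mult = "nat \<times> nat \<times> nat"

text \<open>The three lines are the kernels of \<open>x\<close>, \<open>y\<close> and \<open>x + y\<close>.\<close>

fun D :: "mult \<Rightarrow> 'a::field der set" where
  "D (\<mu>1, \<mu>2, \<mu>3) =
     {\<theta>. X ^ \<mu>1 dvd der_apply \<theta> X \<and> Y ^ \<mu>2 dvd der_apply \<theta> Y \<and>
         (X + Y) ^ \<mu>3 dvd der_apply \<theta> (X + Y)}"

definition Lam :: "nat \<Rightarrow> mult set" where
  "Lam m = {(\<mu>1, \<mu>2, \<mu>3). \<mu>3 = m}"

text \<open>
  If \<open>\<mu>1 > m + 1\<close>, the second sum contains terms with \<open>j > m\<close>; there \<open>m choose j = 0\<close>, so the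
  truncated exponent \<open>m - j\<close> is harmless.
\<close>

fun psi :: "mult \<Rightarrow> 'a::field der" where
  "psi (\<mu>1, \<mu>2, m) =
     (\<Sum>j\<in>{\<mu>1..m}. of_nat (m choose j) * X ^ j * Y ^ (m - j),
      \<Sum>j<\<mu>1. of_nat (m choose j) * X ^ j * Y ^ (m - j))"

fun psi' :: "mult \<Rightarrow> 'a::field der" where
  "psi' (\<mu>1, \<mu>2, m) = der_scale (X ^ \<mu>1 * Y ^ \<mu>2) (-1, 1)"

text \<open>The type argument carries the ground field.\<close>

definition Gam :: "'a::field itself \<Rightarrow> nat \<Rightarrow> mult set" where
  "Gam _ m = {\<mu> \<in> Lam m. is_basis {psi \<mu>, psi' \<mu> :: 'a der} (D \<mu>)}"

definition upper :: "nat \<Rightarrow> mult set \<Rightarrow> mult set" where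
  "upper m T = {\<mu> \<in> Lam m. \<exists>\<nu>\<in>T. \<nu> \<le> \<mu>}"

definition minimal_elements :: "'b::order set \<Rightarrow> 'b set" where
  "minimal_elements A = {a \<in> A. \<forall>b\<in>A. b \<le> a \<longrightarrow> b = a}"

text \<open>
  The conjunct \<open>1 \<le> \<mu>1\<close> expresses the convention that the binomial coefficient \<open>m\<close> over \<open>-1\<close> is \<open>0\<close>:
  subtraction on \<^typ>\<open>nat\<close> truncates, and \<open>m choose (0 - 1)\<close> would be \<open>1\<close>.
\<close>

definition Bset :: "nat \<Rightarrow> nat \<Rightarrow> mult set" where
  "Bset p m = {(\<mu>1, \<mu>2, \<mu>3) \<in> Lam m. \<mu>1 + \<mu>2 = m + 2 \<and>
     1 \<le> \<mu>1 \<and> \<not> [m choose (\<mu>1 - 1) = 0] (mod p)}"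

end

theory Submission
  imports Defs
begin

text \<open>
  The components of \<open>\<psi>\<^sub>\<mu>\<close> sum to \<open>(x + y)\<^sup>m\<close> and those of \<open>\<psi>'\<^sub>\<mu>\<close> to \<open>0\<close>, so the coefficient determinant of the
  pair is \<open>x\<^sup>a y\<^sup>b (x + y)\<^sup>m\<close> with \<open>a = \<mu>\<^sub>1\<close>, \<open>b = \<mu>\<^sub>2\<close>. As in Saito's criterion, the pair is therefore a basis
  of \<open>D(\<A>, \<mu>)\<close> as soon as it lies in it, and the only condition that can fail is that \<open>y\<^sup>b\<close> divides
  the \<open>y\<close>-component of \<open>\<psi>\<^sub>\<mu>\<close>. It fails exactly when some \<open>j < a\<close> with \<open>m choose j\<close> nonzero has
  \<open>m - j < b\<close>, that is, when \<open>(j + 1, m + 1 - j, m) \<le> \<mu>\<close>. These triples form an antichain.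
\<close>

lemma X_power_eq: "(X :: 'a::field bipoly) ^ n = [:monom 1 n:]"
  by (simp add: X_def poly_const_pow monom_altdef)

lemma Y_power_eq: "(Y :: 'a::field bipoly) ^ n = monom 1 n"
  by (simp add: Y_def monom_altdef)

text \<open>\<open>X ^ a\<close> is a constant of the outer polynomial ring, so it divides a
  polynomial iff it divides every coefficient; multiplying by \<open>Y ^ b\<close> only shifts
  coefficients.\<close>

lemma X_power_dvd_Y_power_mult_iff:
  "(X :: 'a::field bipoly) ^ a dvd Y ^ b * h \<longleftrightarrow> X ^ a dvd h"
proof
  assume "X ^ a dvd Y ^ b * h"
  then have "monom 1 a dvd coeff (monom 1 b * h) (n + b)" for n
    by (simp only: X_power_eq Y_power_eq const_poly_dvd_iff)
  then show "X ^ a dvd h"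
    by (simp add: X_power_eq const_poly_dvd_iff coeff_monom_mult)
qed simp

lemma X_power_mult_Y_power_dvd:
  assumes "(X :: 'a::field bipoly) ^ a dvd h" "Y ^ b dvd h"
  shows "X ^ a * Y ^ b dvd h"
proof -
  obtain k where k: "h = Y ^ b * k" using assms(2) by blast
  with assms(1) have "X ^ a dvd k" by (simp only: X_power_dvd_Y_power_mult_iff)
  then show ?thesis
    by (simp add: k mult.commute mult_dvd_mono)
qed

lemma X_neq_0: "(X :: 'a::field bipoly) \<noteq> 0"
  by (simp add: X_def)

lemma Y_neq_0: "(Y :: 'a::field bipoly) \<noteq> 0"
  by (simp add: Y_def)

lemma X_plus_Y_neq_0: "(X + Y :: 'a::field bipoly) \<noteq> 0"
  by (simp add: X_def Y_def)

lemma der_apply_add: "der_apply \<theta> (g + h) = der_apply \<theta> g + der_apply \<theta> h"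
proof -
  have "dX (g + h) = dX g + dX h"
    by (rule poly_eqI) (simp add: dX_def coeff_map_poly pderiv_add)
  then show ?thesis
    by (simp add: der_apply_def dY_def pderiv_add algebra_simps)
qed

lemma D_iff:
  "\<theta> \<in> D (a, b, m) \<longleftrightarrow>
    X ^ a dvd fst \<theta> \<and> Y ^ b dvd snd \<theta> \<and> (X + Y) ^ m dvd fst \<theta> + snd \<theta>"
  by (simp add: der_apply_add der_apply_X der_apply_Y)

lemma subspace_D: "der.subspace (D \<mu> :: 'a::field der set)"
proof -
  obtain a b m where \<mu>: "\<mu> = (a, b, m)" by (cases \<mu>)
  show ?thesis
    unfolding \<mu>
  proof (rule der.subspaceI)
    fix \<theta> \<eta> :: "'a der" and h
    assume \<theta>: "\<theta> \<in> D (a, b, m)"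
    then show "der_scale h \<theta> \<in> D (a, b, m)"
      unfolding D_iff by (simp add: der_scale_def flip: distrib_left)
    assume "\<eta> \<in> D (a, b, m)"
    moreover have "fst (\<theta> + \<eta>) + snd (\<theta> + \<eta>) = (fst \<theta> + snd \<theta>) + (fst \<eta> + snd \<eta>)"
      by (simp add: algebra_simps)
    ultimately show "\<theta> + \<eta> \<in> D (a, b, m)"
      using \<theta> unfolding D_iff by (metis dvd_add fst_add snd_add)
  qed (simp add: D_iff del: D.simps)
qed

lemma psi_components_sum:
  "fst (psi (a, b, m)) + snd (psi (a, b, m)) = (X + Y :: 'a::field bipoly) ^ m"
proof -
  let ?t = "\<lambda>j. of_nat (m choose j) * X ^ j * Y ^ (m - j) :: 'a bipoly"
  have "fst (psi (a, b, m)) + snd (psi (a, b, m)) = sum ?t {a..m} + sum ?t {..<a}"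
    by simp
  also have "\<dots> = sum ?t ({a..m} \<union> {..<a})"
    by (intro sum.union_disjoint[symmetric]) auto
  \<comment> \<open>For \<open>a > m + 1\<close> the union overshoots \<open>m\<close>; the extra
    terms vanish with their binomial coefficient.\<close>
  also have "\<dots> = sum ?t {..m}"
    by (rule sum.mono_neutral_right) (auto simp: binomial_eq_0 not_le)
  also have "\<dots> = (X + Y) ^ m"
    by (simp add: binomial_ring)
  finally show ?thesis .
qed

lemma psi'_components:
  "fst (psi' (a, b, m)) = - (X ^ a * Y ^ b)" "snd (psi' (a, b, m)) = X ^ a * Y ^ b"
  by (simp_all add: der_scale_def)

lemma psi_mem_D_iff:
  "psi (a, b, m) \<in> (D (a, b, m) :: 'a::field der set) \<longleftrightarrow>
    Y ^ b dvd (snd (psi (a, b, m)) :: 'a bipoly)"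
proof -
  have "X ^ a dvd (fst (psi (a, b, m)) :: 'a bipoly)"
    by (auto intro!: dvd_sum dvd_mult2[OF dvd_mult] le_imp_power_dvd)
  then show ?thesis
    by (simp add: D_iff psi_components_sum del: D.simps psi.simps)
qed

lemma psi'_mem_D: "psi' (a, b, m) \<in> D (a, b, m)"
  by (simp add: D_iff psi'_components del: D.simps psi'.simps)

lemma mem_span_psi_iff:
  "\<theta> \<in> der.span {psi \<mu>, psi' \<mu>} \<longleftrightarrow>
    (\<exists>h k. \<theta> = der_scale h (psi \<mu>) + der_scale k (psi' \<mu>))"
  by (auto simp: der.span_insert der.span_singleton diff_eq_eq add.commute)

text \<open>Adding the two components of a relation kills the \<open>psi'\<close> part and leaves
  \<open>h * (X + Y) ^ m = 0\<close>; so \<open>h = 0\<close>, and then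
  \<open>k = 0\<close>.\<close>

lemma independent_psi: "der.independent {psi (a, b, m), psi' (a, b, m) :: 'a::field der}"
proof -
  let ?\<psi> = "psi (a, b, m) :: 'a der" and ?\<psi>' = "psi' (a, b, m) :: 'a der"
  have nz: "(X + Y :: 'a bipoly) ^ m \<noteq> 0" "(X :: 'a bipoly) ^ a * Y ^ b \<noteq> 0"
    using X_plus_Y_neq_0 X_neq_0 Y_neq_0 by auto
  \<comment> \<open>If the two coincided, the set would be a singleton and could not carry two
    separate coefficients. Their component sums, \<open>(X + Y) ^ m\<close> and 0, differ.\<close>
  have ne: "?\<psi> \<noteq> ?\<psi>'"
    using nz(1) psi_components_sum[of a b m, where 'a = 'a]
    by (metis psi'_components add.left_inverse)
  have "h = 0 \<and> k = 0" if eq: "der_scale h ?\<psi> + der_scale k ?\<psi>' = 0" for h k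
  proof -
    have f: "h * fst ?\<psi> - k * (X ^ a * Y ^ b) = 0" and s: "h * snd ?\<psi> + k * (X ^ a * Y ^ b) = 0"
      using arg_cong[OF eq, of fst] arg_cong[OF eq, of snd]
      by (simp_all add: der_scale_def psi'_components del: psi.simps psi'.simps)
    have "h * (X + Y) ^ m = 0"
      using f s unfolding psi_components_sum[of a b m, symmetric] by (simp add: algebra_simps del: psi.simps)
    then have "h = 0" using nz(1) mult_eq_0_iff by blast
    with s have "k * (X ^ a * Y ^ b) = 0" by (simp del: psi.simps)
    then show ?thesis using nz(2) \<open>h = 0\<close> mult_eq_0_iff by blast
  qed
  then show ?thesis
    using ne by (auto simp: der.dependent_finite simp del: psi.simps psi'.simps)
qed

lemma is_basis_psi_iff:
  "is_basis {psi (a, b, m), psi' (a, b, m)} (D (a, b, m) :: 'a::field der set) \<longleftrightarrow>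
    Y ^ b dvd (snd (psi (a, b, m)) :: 'a bipoly)"
    (is "is_basis {?\<psi>, ?\<psi>'} ?D \<longleftrightarrow> ?dvd")
proof
  assume "is_basis {?\<psi>, ?\<psi>'} ?D"
  then have "?\<psi> \<in> ?D"
    unfolding is_basis_def by (metis der.span_base insertI1)
  then show ?dvd by (simp only: psi_mem_D_iff)
next
  assume dvd: ?dvd
  then have mem: "?\<psi> \<in> ?D" by (simp only: psi_mem_D_iff)
  have "\<theta> \<in> der.span {?\<psi>, ?\<psi>'}" if \<theta>: "\<theta> \<in> ?D" for \<theta>
  proof -
    obtain h where h: "fst \<theta> + snd \<theta> = (X + Y) ^ m * h"
      using \<theta> unfolding D_iff by blast
    \<comment> \<open>Subtracting this multiple makes the component sum zero, so the remainder is
      \<open>(-g, g)\<close>. Membership in \<open>D\<close> puts both \<open>X ^ a\<close> and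
      \<open>Y ^ b\<close> into \<open>g\<close>, which makes it a multiple of
      \<open>psi'\<close>.\<close>
    define r where "r = \<theta> - der_scale h ?\<psi>"
    have "r \<in> ?D"
      unfolding r_def using \<theta> mem subspace_D by (metis der.subspace_diff der.subspace_scale)
    then have "X ^ a dvd fst r" "Y ^ b dvd snd r"
      by (auto simp: D_iff simp del: D.simps)
    moreover have "fst r + snd r = (fst \<theta> + snd \<theta>) - h * (fst ?\<psi> + snd ?\<psi>)"
      by (simp add: r_def der_scale_def algebra_simps del: psi.simps)
    then have r0: "fst r = - snd r"
      by (simp add: psi_components_sum h mult.commute eq_neg_iff_add_eq_0 del: psi.simps)
    ultimately have "X ^ a * Y ^ b dvd snd r"
      by (intro X_power_mult_Y_power_dvd) auto
    then obtain k where "snd r = X ^ a * Y ^ b * k" by blast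
    with r0 have "r = der_scale k ?\<psi>'"
      by (simp add: der_scale_def psi'_components prod_eq_iff mult.commute del: psi'.simps)
    then have "\<theta> = der_scale h ?\<psi> + der_scale k ?\<psi>'"
      by (metis r_def add.commute diff_add_cancel)
    then show ?thesis
      using mem_span_psi_iff by blast
  qed
  moreover have "der.span {?\<psi>, ?\<psi>'} \<subseteq> ?D"
    using mem psi'_mem_D subspace_D by (intro der.span_minimal) auto
  ultimately show "is_basis {?\<psi>, ?\<psi>'} ?D"
    unfolding is_basis_def using independent_psi by blast
qed

text \<open>Terms with distinct \<open>j \<le> m\<close> have distinct powers of \<open>Y\<close>,
  so nothing cancels and each term of \<open>Y\<close>-degree below \<open>b\<close> must vanish by
  itself.\<close>

lemma Y_power_dvd_snd_psi_iff:
  "Y ^ b dvd (snd (psi (a, c, m)) :: 'a::field bipoly) \<longleftrightarrow>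
    (\<forall>j<a. j \<le> m \<longrightarrow> m - j < b \<longrightarrow> of_nat (m choose j) = (0 :: 'a))"
proof -
  have summand: "of_nat (m choose j) * X ^ j * Y ^ (m - j)
      = (monom (monom (of_nat (m choose j)) j) (m - j) :: 'a bipoly)" for j
    by (simp add: X_power_eq Y_power_eq of_nat_poly smult_monom)
  have coeff: "coeff (snd (psi (a, c, m)) :: 'a bipoly) k
      = (if k \<le> m \<and> m - k < a then monom (of_nat (m choose (m - k))) (m - k) else 0)" for k
  proof -
    have "coeff (snd (psi (a, c, m)) :: 'a bipoly) k
        = (\<Sum>j<a. if m - j = k then monom (of_nat (m choose j)) j else 0)"
      by (simp add: summand coeff_sum)
    \<comment> \<open>Truncated subtraction gives \<open>m - j = 0\<close> for \<open>j > m\<close>,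
      but there the binomial coefficient is 0; no \<open>j\<close> yields
      \<open>k > m\<close>.\<close>
    also have "\<dots> = (\<Sum>j<a. if j = m - k then
        if k \<le> m then monom (of_nat (m choose j)) j else 0 else 0)"
      by (rule sum.cong) (auto simp: binomial_eq_0)
    finally show ?thesis by simp
  qed
  have "Y ^ b dvd (snd (psi (a, c, m)) :: 'a bipoly) \<longleftrightarrow>
      (\<forall>k<b. k \<le> m \<longrightarrow> m - k < a \<longrightarrow> of_nat (m choose (m - k)) = (0 :: 'a))"
    unfolding Y_power_eq monom_1_dvd_iff' coeff by auto
  also have "\<dots> \<longleftrightarrow> (\<forall>j<a. j \<le> m \<longrightarrow> m - j < b \<longrightarrow> of_nat (m choose j) = (0 :: 'a))"
    by (metis diff_diff_cancel diff_le_self)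
  finally show ?thesis .
qed

lemma mem_Gam_iff:
  "(a, b, m) \<in> Gam TYPE('p::prime_card mod_ring) m \<longleftrightarrow>
    (\<forall>j<a. j \<le> m \<longrightarrow> m - j < b \<longrightarrow> [m choose j = 0] (mod CARD('p)))"
  by (simp add: Gam_def Lam_def is_basis_psi_iff Y_power_dvd_snd_psi_iff of_nat_eq_0_iff_char_dvd
      cong_0_iff del: psi.simps psi'.simps D.simps)

lemma Lam_diff_Gam_eq_upper:
  "Lam m - Gam TYPE('p::prime_card mod_ring) m = upper m (Bset CARD('p) m)"
proof -
  have "(a, b, m) \<notin> Gam TYPE('p mod_ring) m \<longleftrightarrow> (\<exists>\<nu>\<in>Bset CARD('p) m. \<nu> \<le> (a, b, m))"
    for a b
  proof
    assume "(a, b, m) \<notin> Gam TYPE('p mod_ring) m"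
    then obtain j where "j < a" "j \<le> m" "m - j < b" "\<not> [m choose j = 0] (mod CARD('p))"
      by (auto simp: mem_Gam_iff)
    then show "\<exists>\<nu>\<in>Bset CARD('p) m. \<nu> \<le> (a, b, m)"
      \<comment> \<open>The least triple that satisfies both strict inequalities for this
        \<open>j\<close>.\<close>
      by (intro bexI[of _ "(Suc j, Suc (m - j), m)"]) (auto simp: Bset_def Lam_def)
  next
    assume "\<exists>\<nu>\<in>Bset CARD('p) m. \<nu> \<le> (a, b, m)"
    then obtain c d where cd: "c \<le> a" "d \<le> b" "c + d = m + 2" "1 \<le> c"
        "\<not> [m choose (c - 1) = 0] (mod CARD('p))"
      by (auto simp: Bset_def Lam_def)
    \<comment> \<open>Hence \<open>d = m - (c - 1) + 1\<close> without truncation, so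
      \<open>j = c - 1\<close> meets \<open>m - j < d \<le> b\<close>.\<close>
    then have "c - 1 \<le> m"
      by (metis binomial_eq_0 cong_refl not_le)
    with cd show "(a, b, m) \<notin> Gam TYPE('p mod_ring) m"
      by (auto simp: mem_Gam_iff intro!: exI[of _ "c - 1"])
  qed
  then show ?thesis
    by (auto simp: upper_def Lam_def)
qed

text \<open>Every element of the upper set lies above a generator, so a minimal one is a generator.
  Conversely, anything below a generator lies above another one, and the antichain condition forces
  all three to agree.\<close>

lemma minimal_elements_upper:
  assumes "T \<subseteq> Lam m" and antichain: "\<And>\<mu> \<nu>. \<mu> \<in> T \<Longrightarrow> \<nu> \<in> T \<Longrightarrow> \<mu> \<le> \<nu> \<Longrightarrow> \<mu> = \<nu>"
  shows "minimal_elements (upper m T) = T"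
proof
  show "minimal_elements (upper m T) \<subseteq> T"
    using assms(1) by (fastforce simp: minimal_elements_def upper_def)
  show "T \<subseteq> minimal_elements (upper m T)"
  proof
    fix \<mu> assume \<mu>: "\<mu> \<in> T"
    have "\<nu> = \<mu>" if "\<nu> \<in> upper m T" "\<nu> \<le> \<mu>" for \<nu>
      using that antichain \<mu> unfolding upper_def by (blast intro: order.trans order.antisym)
    then show "\<mu> \<in> minimal_elements (upper m T)"
      using assms(1) \<mu> by (auto simp: minimal_elements_def upper_def)
  qed
qed

theorem theorem5p8:
  fixes m :: nat
  assumes "m > 0"
  shows "Bset CARD('p::prime_card) m = minimal_elements (Lam m - Gam TYPE('p mod_ring) m) \<and>
         Lam m - Gam TYPE('p mod_ring) m = upper m (Bset CARD('p) m)"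
proof -
  \<comment> \<open>The sum of the first two entries is fixed at \<open>m + 2\<close> on
    \<open>Bset\<close>, so comparable elements are equal.\<close>
  have "minimal_elements (upper m (Bset CARD('p) m)) = Bset CARD('p) m"
    by (rule minimal_elements_upper) (auto simp: Bset_def Lam_def)
  then show ?thesis
    by (simp add: Lam_diff_Gam_eq_upper)
qed

end
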